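(* Let $X$ and $B$ be ordered groups with positive cones $P_X$ and $P_B$, let $\varphi\colon B\times X\to X$ be an action of the group $B$ on the group $X$ by group automorphisms $\varphi_b=\varphi(b,-)$, and suppose that the set of compatible positive cones on $X\rtimes_\varphi B$ is nonempty. Let $P_{\prod}=P_X\times P_B$. Then: (1) there is a least compatible positive cone on $X\rtimes_\varphi B$ (with respect to inclusion), and it is $\langle P_{\prod}\rangle$, the positive cone generated by $P_X\times P_B$; (2) moreover, it coincides with $P_{\prod}$ if and only if $\varphi_b\sim\mathrm{id}$ (i.e. $\varphi_b(x)\sim x$ for all $x\in X$) for every positive element $b$ of $B$.
   Context: "Order" means preorder (reflexive and transitive, not necessarily antisymmetric). An ordered group is a (not necessarily abelian) group, written additively, with an order $\leq$ for which addition is monotone. Write $x\sim y$ for $x\leq y$ and $y\leq x$. The positive cone of an ordered group $X$ is $P_X=\{x\in X: x\geq 0\}$; an element is positive if it is $\ge 0$. A positive cone on a group is a submonoid closed under conjugation, and positive cones correspond bijectively to group orders (with $x\le y$ iff $y-x\in P$). For a subset $A$ of a group, $\langle A\rangle$ denotes the least positive cone containing $A$, obtained by first closing $A$ under conjugation and then closing the result under addition. $\mathsf{OrdGrp}$ is the category of ordered groups and monotone group homomorphisms. The semidirect product $X\rtimes_\varphi B$ has underlying set $X\times B$ and operation $(x,b)+(x',b')=(x+\varphi_b(x'),b+b')$. A positive cone $P$ on $X\rtimes_\varphi B$ is called compatible if, with the order given by $P$, the sequence $X\xrightarrow{\langle 1,0\rangle}X\rtimes_\varphi B\xrightarrow{\pi_B}B$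 together with the section $\langle 0,1\rangle\colon B\to X\rtimes_\varphi B$ is a split extension in $\mathsf{OrdGrp}$, where $\langle 1,0\rangle(x)=(x,0)$, $\pi_B(x,b)=b$, $\langle 0,1\rangle(b)=(0,b)$; that is, all three maps are monotone, $\langle 1,0\rangle$ is a kernel of $\pi_B$ and $\pi_B$ is a cokernel of $\langle 1,0\rangle$ in $\mathsf{OrdGrp}$. (A kernel in $\mathsf{OrdGrp}$ is a group-theoretic kernel carrying the order induced from the domain.) *)

theory Defs
  imports "HOL-Algebra.Group_Action" "HOL.Hull"
begin

text \<open>Groups are HOL-Algebra groups, hence written multiplicatively although the mathematics is
  usually written additively: \<open>\<one>\<close> is the zero, \<open>y \<otimes> inv x\<close> is \<open>y - x\<close>.
  ``Order'' always means preorder, and orders matter only on the carrier.\<close>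

record 'a ord_group = "'a monoid" +
  leq :: "'a \<Rightarrow> 'a \<Rightarrow> bool" (infixl \<open>\<preceq>\<index>\<close> 50)

locale ordered_group = group G for G :: "'a ord_group" (structure) +
  assumes leq_refl: "x \<in> carrier G \<Longrightarrow> x \<preceq> x"
    and leq_trans:
      "\<lbrakk>x \<in> carrier G; y \<in> carrier G; z \<in> carrier G; x \<preceq> y; y \<preceq> z\<rbrakk> \<Longrightarrow> x \<preceq> z"
    and mult_mono:
      "\<lbrakk>x \<in> carrier G; y \<in> carrier G; u \<in> carrier G; v \<in> carrier G; x \<preceq> y; u \<preceq> v\<rbrakk>
        \<Longrightarrow> x \<otimes> u \<preceq> y \<otimes> v"

definition order_equiv :: "'a ord_group \<Rightarrow> 'a \<Rightarrow> 'a \<Rightarrow> bool" where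
  "order_equiv G x y \<longleftrightarrow> x \<preceq>\<^bsub>G\<^esub> y \<and> y \<preceq>\<^bsub>G\<^esub> x"

definition pos_elems :: "'a ord_group \<Rightarrow> 'a set" where
  "pos_elems G = {x \<in> carrier G. \<one>\<^bsub>G\<^esub> \<preceq>\<^bsub>G\<^esub> x}"

definition positive_cone :: "('a, 'm) monoid_scheme \<Rightarrow> 'a set \<Rightarrow> bool" where
  "positive_cone G P \<longleftrightarrow> submonoid P G \<and>
     (\<forall>g\<in>carrier G. \<forall>p\<in>P. g \<otimes>\<^bsub>G\<^esub> p \<otimes>\<^bsub>G\<^esub> inv\<^bsub>G\<^esub> g \<in> P)"

definition generated_cone :: "('a, 'm) monoid_scheme \<Rightarrow> 'a set \<Rightarrow> 'a set" where
  "generated_cone G A = positive_cone G hull A"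

definition ord_by_cone :: "'a monoid \<Rightarrow> 'a set \<Rightarrow> 'a ord_group" where
  "ord_by_cone G P =
     \<lparr>carrier = carrier G, mult = mult G, one = one G,
      leq = (\<lambda>x y. y \<otimes>\<^bsub>G\<^esub> inv\<^bsub>G\<^esub> x \<in> P)\<rparr>"

definition ord_hom :: "'a ord_group \<Rightarrow> 'b ord_group \<Rightarrow> ('a \<Rightarrow> 'b) set" where
  "ord_hom G H = {f \<in> hom G H.
     \<forall>x\<in>carrier G. \<forall>y\<in>carrier G. x \<preceq>\<^bsub>G\<^esub> y \<longrightarrow> f x \<preceq>\<^bsub>H\<^esub> f y}"

text \<open>A kernel is a group-theoretic kernel carrying the induced order.\<close>

definition ord_kernel ::
  "'a ord_group \<Rightarrow> 'e ord_group \<Rightarrow> 'q ord_group \<Rightarrow> ('a \<Rightarrow> 'e) \<Rightarrow> ('e \<Rightarrow> 'q) \<Rightarrow> bool" where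
  "ord_kernel A E Q k p \<longleftrightarrow>
     k \<in> ord_hom A E \<and> inj_on k (carrier A) \<and> k ` carrier A = kernel E Q p \<and>
     (\<forall>x\<in>carrier A. \<forall>y\<in>carrier A. x \<preceq>\<^bsub>A\<^esub> y \<longleftrightarrow> k x \<preceq>\<^bsub>E\<^esub> k y)"

text \<open>The universal property of a cokernel quantifies over all ordered groups; in HOL the test
  objects \<open>Z\<close> have to live on a type \<open>'z\<close>, which is made an explicit parameter.\<close>

definition ord_cokernel ::
  "'z itself \<Rightarrow> 'a ord_group \<Rightarrow> 'e ord_group \<Rightarrow> 'q ord_group \<Rightarrow> ('a \<Rightarrow> 'e) \<Rightarrow> ('e \<Rightarrow> 'q) \<Rightarrow> bool"
  where
  "ord_cokernel (TYPE('z)) A E Q k p \<longleftrightarrow>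
     p \<in> ord_hom E Q \<and> (\<forall>a\<in>carrier A. p (k a) = \<one>\<^bsub>Q\<^esub>) \<and>
     (\<forall>Z :: 'z ord_group. ordered_group Z \<longrightarrow>
        (\<forall>f\<in>ord_hom E Z. (\<forall>a\<in>carrier A. f (k a) = \<one>\<^bsub>Z\<^esub>) \<longrightarrow>
           (\<exists>g\<in>ord_hom Q Z. (\<forall>e\<in>carrier E. g (p e) = f e) \<and>
              (\<forall>h\<in>ord_hom Q Z. (\<forall>e\<in>carrier E. h (p e) = f e) \<longrightarrow>
                 (\<forall>q\<in>carrier Q. h q = g q)))))"

text \<open>Here the cokernel property is tested on ordered groups living on the type of the middle
  object. The lemma below shows that it then holds for ordered groups on every type, so this is
  the unrestricted categorical notion.\<close>

definition split_extension ::
  "'a ord_group \<Rightarrow> 'e ord_group \<Rightarrow> 'q ord_group \<Rightarrow> ('a \<Rightarrow> 'e) \<Rightarrow> ('e \<Rightarrow> 'q) \<Rightarrow> ('q \<Rightarrow> 'e) \<Rightarrow> bool"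
  where
  "split_extension A (E :: 'e ord_group) Q k p s \<longleftrightarrow>
     ordered_group A \<and> ordered_group E \<and> ordered_group Q \<and>
     k \<in> ord_hom A E \<and> p \<in> ord_hom E Q \<and> s \<in> ord_hom Q E \<and>
     (\<forall>q\<in>carrier Q. p (s q) = q) \<and>
     ord_kernel A E Q k p \<and> ord_cokernel TYPE('e) A E Q k p"

lemma split_extension_cokernel:
  assumes "split_extension A E Q k p s"
  shows "ord_cokernel TYPE('z) A E Q k p"
proof -
  have A: "ordered_group A" and E: "ordered_group E" and Q: "ordered_group Q"
    and p: "p \<in> ord_hom E Q" and s: "s \<in> ord_hom Q E"
    and ps: "\<And>q. q \<in> carrier Q \<Longrightarrow> p (s q) = q"
    and img: "k ` carrier A = kernel E Q p"
    and pk: "\<And>a. a \<in> carrier A \<Longrightarrow> p (k a) = \<one>\<^bsub>Q\<^esub>"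
    using assms by (auto simp: split_extension_def ord_kernel_def ord_cokernel_def)
  interpret E: ordered_group E by (fact E)
  interpret Q: ordered_group Q by (fact Q)
  interpret p: group_hom E Q p
    using p by unfold_locales (auto simp: ord_hom_def)
  have pc: "p e \<in> carrier Q" if "e \<in> carrier E" for e using that by simp
  have sc: "s q \<in> carrier E" if "q \<in> carrier Q" for q
    using s that by (auto simp: ord_hom_def hom_def)
  have "\<exists>g\<in>ord_hom Q Z. (\<forall>e\<in>carrier E. g (p e) = f e) \<and>
              (\<forall>h\<in>ord_hom Q Z. (\<forall>e\<in>carrier E. h (p e) = f e) \<longrightarrow>
                 (\<forall>q\<in>carrier Q. h q = g q))"
    if Z: "ordered_group Z" and f: "f \<in> ord_hom E Z"
      and fk: "\<forall>a\<in>carrier A. f (k a) = \<one>\<^bsub>Z\<^esub>" for Z :: "'z ord_group" and f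
  proof (intro bexI[of _ "f \<circ> s"] conjI ballI impI)
    interpret Z: ordered_group Z by (fact Z)
    interpret f: group_hom E Z f
      using f by unfold_locales (auto simp: ord_hom_def)
    show "(f \<circ> s) (p e) = f e" if e: "e \<in> carrier E" for e
    proof -
      have c: "s (p e) \<in> carrier E" using sc pc e by blast
      have "e \<otimes>\<^bsub>E\<^esub> inv\<^bsub>E\<^esub> s (p e) \<in> kernel E Q p"
        using e c ps[OF pc[OF e]] by (simp add: kernel_def)
      then obtain a where a: "a \<in> carrier A" "e \<otimes>\<^bsub>E\<^esub> inv\<^bsub>E\<^esub> s (p e) = k a"
        using img by auto
      then have "f (e \<otimes>\<^bsub>E\<^esub> inv\<^bsub>E\<^esub> s (p e)) = \<one>\<^bsub>Z\<^esub>" using fk by simp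
      then have "f e \<otimes>\<^bsub>Z\<^esub> inv\<^bsub>Z\<^esub> f (s (p e)) = \<one>\<^bsub>Z\<^esub>" using e c by simp
      then show ?thesis
        using e c Z.inv_solve_right'[of "\<one>\<^bsub>Z\<^esub>" "f e" "f (s (p e))"] by simp
    qed
    show "h q = (f \<circ> s) q"
      if "h \<in> ord_hom Q Z" "\<forall>e\<in>carrier E. h (p e) = f e" "q \<in> carrier Q" for h q
      using that ps sc by (metis comp_apply)
    show "f \<circ> s \<in> ord_hom Q Z"
      using f s by (auto simp: ord_hom_def hom_def Pi_iff)
  qed
  then show ?thesis using p pk by (simp add: ord_cokernel_def)
qed

definition semidirect ::
  "('x, 'm) monoid_scheme \<Rightarrow> ('b, 'n) monoid_scheme \<Rightarrow> ('b \<Rightarrow> 'x \<Rightarrow> 'x) \<Rightarrow> ('x \<times> 'b) monoid" where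
  "semidirect X B \<phi> =
     \<lparr>carrier = carrier X \<times> carrier B,
      mult = (\<lambda>(x, b) (x', b'). (x \<otimes>\<^bsub>X\<^esub> \<phi> b x', b \<otimes>\<^bsub>B\<^esub> b')),
      one = (\<one>\<^bsub>X\<^esub>, \<one>\<^bsub>B\<^esub>)\<rparr>"

definition compatible_cone ::
  "'x ord_group \<Rightarrow> 'b ord_group \<Rightarrow> ('b \<Rightarrow> 'x \<Rightarrow> 'x) \<Rightarrow> ('x \<times> 'b) set \<Rightarrow> bool" where
  "compatible_cone X B \<phi> P \<longleftrightarrow>
     positive_cone (semidirect X B \<phi>) P \<and>
     split_extension X (ord_by_cone (semidirect X B \<phi>) P) B
       (\<lambda>x. (x, \<one>\<^bsub>B\<^esub>)) snd (\<lambda>b. (\<one>\<^bsub>X\<^esub>, b))"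

end

theory Submission
  imports Defs
begin

text \<open>A positive cone \<open>P\<close> on the semidirect product is compatible iff \<open>P\<close> meets the image of \<open>X\<close>
  exactly in \<open>P\<^sub>X\<close>, contains the image of \<open>P\<^sub>B\<close>, and projects into \<open>P\<^sub>B\<close>; the cokernel condition is
  automatic because the projection splits. As \<open>(x, b) = (x, \<one>) (\<one>, b)\<close>, each compatible cone contains
  \<open>P\<^sub>X \<times> P\<^sub>B\<close>, and hence the cone it generates. Conversely the generated cone, squeezed between
  \<open>P\<^sub>X \<times> P\<^sub>B\<close> and some compatible cone, is itself compatible. It equals \<open>P\<^sub>X \<times> P\<^sub>B\<close> iff the
  latter is a cone. Conjugating \<open>(\<one>, b)\<close> by \<open>(x, \<one>)\<close> yields \<open>(x (\<phi>\<^sub>b x)\<inverse>, b)\<close>, which forces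
  \<open>\<phi>\<^sub>b \<sim> id\<close>; for the converse one also needs that each \<open>\<phi>\<^sub>c\<close> preserves \<open>P\<^sub>X\<close>, which holds since
  conjugation by \<open>(\<one>, c)\<close> preserves a compatible cone.\<close>

section \<open>Positive cones\<close>

lemma positive_coneI:
  assumes "P \<subseteq> carrier G" "\<one>\<^bsub>G\<^esub> \<in> P"
    and "\<And>p q. \<lbrakk>p \<in> P; q \<in> P\<rbrakk> \<Longrightarrow> p \<otimes>\<^bsub>G\<^esub> q \<in> P"
    and "\<And>g p. \<lbrakk>g \<in> carrier G; p \<in> P\<rbrakk> \<Longrightarrow> g \<otimes>\<^bsub>G\<^esub> p \<otimes>\<^bsub>G\<^esub> inv\<^bsub>G\<^esub> g \<in> P"
  shows "positive_cone G P"
  using assms by (auto simp: positive_cone_def submonoid_def)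

lemma positive_coneD:
  assumes "positive_cone G P"
  shows "P \<subseteq> carrier G" "\<one>\<^bsub>G\<^esub> \<in> P"
    and "\<lbrakk>p \<in> P; q \<in> P\<rbrakk> \<Longrightarrow> p \<otimes>\<^bsub>G\<^esub> q \<in> P"
    and "\<lbrakk>g \<in> carrier G; p \<in> P\<rbrakk> \<Longrightarrow> g \<otimes>\<^bsub>G\<^esub> p \<otimes>\<^bsub>G\<^esub> inv\<^bsub>G\<^esub> g \<in> P"
  using assms by (auto simp: positive_cone_def submonoid_def)

lemma generated_cone_superset: "A \<subseteq> generated_cone G A"
  by (simp add: generated_cone_def hull_subset)

lemma generated_cone_minimal:
  "\<lbrakk>positive_cone G P; A \<subseteq> P\<rbrakk> \<Longrightarrow> generated_cone G A \<subseteq> P"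
  by (simp add: generated_cone_def hull_minimal)

lemma (in group) positive_cone_carrier: "positive_cone G (carrier G)"
  by (rule positive_coneI) auto

text \<open>Every cone axiom passes to intersections. \<open>A \<subseteq> carrier G\<close> makes
  the carrier one of the intersected cones; otherwise the family would be empty and the hull would
  be \<open>UNIV\<close>.\<close>

lemma (in group) positive_cone_generated_cone:
  assumes "A \<subseteq> carrier G"
  shows "positive_cone G (generated_cone G A)"
proof (rule positive_coneI)
  show "generated_cone G A \<subseteq> carrier G"
    using assms by (intro generated_cone_minimal positive_cone_carrier)
qed (auto simp: generated_cone_def hull_def intro: positive_coneD)

text \<open>The fixed points of the closure operator are the cones. This turns the second claim into
  the question when the product of the two positive cones is itself a cone.\<close>

lemma (in group) generated_cone_eq_iff:
  assumes "A \<subseteq> carrier G"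
  shows "generated_cone G A = A \<longleftrightarrow> positive_cone G A"
  using positive_cone_generated_cone[OF assms] generated_cone_minimal[of G A A]
    generated_cone_superset[of A G] by auto

section \<open>From a group order to its positive cone\<close>

context ordered_group
begin

lemma leq_iff_pos:
  assumes "x \<in> carrier G" "y \<in> carrier G"
  shows "x \<preceq> y \<longleftrightarrow> y \<otimes> inv x \<in> pos_elems G"
proof
  assume "x \<preceq> y"
  then show "y \<otimes> inv x \<in> pos_elems G"
    using assms mult_mono[of x y "inv x" "inv x"] by (simp add: pos_elems_def leq_refl)
next
  assume "y \<otimes> inv x \<in> pos_elems G"
  then show "x \<preceq> y"
    using assms mult_mono[of \<one> "y \<otimes> inv x" x x]
    by (simp add: pos_elems_def leq_refl m_assoc)
qed

lemma pos_elems_closed: "p \<in> pos_elems G \<Longrightarrow> p \<in> carrier G"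
  by (simp add: pos_elems_def)

lemma pos_elems_trans:
  "\<lbrakk>p \<in> pos_elems G; p \<preceq> q; q \<in> carrier G\<rbrakk> \<Longrightarrow> q \<in> pos_elems G"
  by (auto simp: pos_elems_def intro: leq_trans[of \<one> p q])

lemma positive_cone_pos_elems: "positive_cone G (pos_elems G)"
proof (rule positive_coneI)
  show "p \<otimes> q \<in> pos_elems G" if "p \<in> pos_elems G" "q \<in> pos_elems G" for p q
    using that mult_mono[of \<one> p \<one> q] by (simp add: pos_elems_def)
  show "g \<otimes> p \<otimes> inv g \<in> pos_elems G" if "g \<in> carrier G" "p \<in> pos_elems G" for g p
  proof -
    \<comment> \<open>The conjugate of \<open>p\<close> by \<open>g\<close> is the difference of
      \<open>g \<otimes> p\<close> and \<open>g\<close>, so its positivity is this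
      comparison.\<close>
    have "g \<preceq> g \<otimes> p"
      using that mult_mono[of g g \<one> p] by (simp add: pos_elems_def leq_refl)
    then show ?thesis using that leq_iff_pos[of g "g \<otimes> p"] by (simp add: pos_elems_def)
  qed
qed (auto simp: pos_elems_def leq_refl)

end

lemma ord_by_cone_simps [simp]:
  "carrier (ord_by_cone G P) = carrier G"
  "x \<otimes>\<^bsub>ord_by_cone G P\<^esub> y = x \<otimes>\<^bsub>G\<^esub> y"
  "\<one>\<^bsub>ord_by_cone G P\<^esub> = \<one>\<^bsub>G\<^esub>"
  "x \<preceq>\<^bsub>ord_by_cone G P\<^esub> y \<longleftrightarrow> y \<otimes>\<^bsub>G\<^esub> inv\<^bsub>G\<^esub> x \<in> P"
  by (simp_all add: ord_by_cone_def)

text \<open>Reflexivity comes from the unit in \<open>P\<close>, transitivity from closure under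
  products, and monotonicity from products together with conjugation.\<close>

lemma ordered_group_ord_by_cone:
  fixes G :: "'a monoid" (structure)
  assumes "group G" and P: "positive_cone G P"
  shows "ordered_group (ord_by_cone G P)"
proof -
  interpret group G by fact
  note PD = positive_coneD[OF P]
  show ?thesis
  proof (intro ordered_group.intro ordered_group_axioms.intro; (unfold ord_by_cone_simps)?)
    show "group (ord_by_cone G P)"
      by (rule groupI) (auto simp: m_assoc intro: l_inv)
    show "x \<otimes> inv x \<in> P" if "x \<in> carrier G" for x
      using that PD(2) by simp
    show "z \<otimes> inv x \<in> P"
      if "x \<in> carrier G" "y \<in> carrier G" "z \<in> carrier G" "y \<otimes> inv x \<in> P" "z \<otimes> inv y \<in> P"
      for x y z
    proof -
      have "z \<otimes> inv x = (z \<otimes> inv y) \<otimes> (y \<otimes> inv x)"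
        using that by (simp add: m_assoc inv_solve_left)
      then show ?thesis using PD(3) that by simp
    qed
    show "(y \<otimes> v) \<otimes> inv (x \<otimes> u) \<in> P"
      if "x \<in> carrier G" "y \<in> carrier G" "u \<in> carrier G" "v \<in> carrier G"
        "y \<otimes> inv x \<in> P" "v \<otimes> inv u \<in> P" for x y u v
    proof -
      \<comment> \<open>The difference of the products splits into the conjugate by \<open>y\<close>
        of the second difference, times the first difference.\<close>
      have "(y \<otimes> v) \<otimes> inv (x \<otimes> u) = (y \<otimes> (v \<otimes> inv u) \<otimes> inv y) \<otimes> (y \<otimes> inv x)"
        using that m_assoc[of "inv y" y "inv x"] by (simp add: m_assoc inv_mult_group)
      then show ?thesis using PD(3,4) that by simp
    qed
  qed
qed

lemma ord_hom_comp:
  assumes "f \<in> ord_hom G H" "g \<in> ord_hom H K"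
  shows "g \<circ> f \<in> ord_hom G K"
  using assms by (auto simp: ord_hom_def hom_def Pi_iff)

section \<open>Compatible cones on a semidirect product\<close>

text \<open>\<open>group_action\<close> yields bijections of the carrier, and
  \<open>action_hom\<close> makes them automorphisms. Monotonicity of each \<open>\<phi> b\<close>
  is not assumed; \<open>action_pos\<close> derives it from a compatible cone.\<close>

locale ordered_group_action =
  X: ordered_group X + B: ordered_group B + action: group_action B "carrier X" \<phi>
  for X :: "'x ord_group" and B :: "'b ord_group" and \<phi> +
  assumes action_hom: "b \<in> carrier B \<Longrightarrow> \<phi> b \<in> hom X X"
begin

lemma action_closed [simp]: "\<lbrakk>b \<in> carrier B; x \<in> carrier X\<rbrakk> \<Longrightarrow> \<phi> b x \<in> carrier X"
  using action_hom by (auto simp: hom_def)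

lemma action_mult [simp]:
  "\<lbrakk>b \<in> carrier B; x \<in> carrier X; y \<in> carrier X\<rbrakk> \<Longrightarrow> \<phi> b (x \<otimes>\<^bsub>X\<^esub> y) = \<phi> b x \<otimes>\<^bsub>X\<^esub> \<phi> b y"
  using action_hom by (auto simp: hom_def)

lemma group_hom_action: "b \<in> carrier B \<Longrightarrow> group_hom X X (\<phi> b)"
  using action_hom by unfold_locales

lemma action_one [simp]: "b \<in> carrier B \<Longrightarrow> \<phi> b \<one>\<^bsub>X\<^esub> = \<one>\<^bsub>X\<^esub>"
  by (rule group_hom.hom_one[OF group_hom_action])

lemma action_inv [simp]:
  "\<lbrakk>b \<in> carrier B; x \<in> carrier X\<rbrakk> \<Longrightarrow> \<phi> b (inv\<^bsub>X\<^esub> x) = inv\<^bsub>X\<^esub> \<phi> b x"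
  by (rule group_hom.hom_inv[OF group_hom_action])

lemma action_id [simp]: "x \<in> carrier X \<Longrightarrow> \<phi> \<one>\<^bsub>B\<^esub> x = x"
  by (metis action.id_eq_one restrict_apply')

lemma action_comp:
  "\<lbrakk>b \<in> carrier B; c \<in> carrier B; x \<in> carrier X\<rbrakk> \<Longrightarrow> \<phi> (b \<otimes>\<^bsub>B\<^esub> c) x = \<phi> b (\<phi> c x)"
  by (rule action.composition_rule)

section \<open>The semidirect product as a group\<close>

abbreviation S where "S \<equiv> semidirect X B \<phi>"

lemma semidirect_simps [simp]:
  "carrier S = carrier X \<times> carrier B"
  "(x, b) \<otimes>\<^bsub>S\<^esub> (y, c) = (x \<otimes>\<^bsub>X\<^esub> \<phi> b y, b \<otimes>\<^bsub>B\<^esub> c)"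
  "\<one>\<^bsub>S\<^esub> = (\<one>\<^bsub>X\<^esub>, \<one>\<^bsub>B\<^esub>)"
  by (simp_all add: semidirect_def)

lemma semidirect_l_inv:
  assumes "x \<in> carrier X" "b \<in> carrier B"
  shows "(\<phi> (inv\<^bsub>B\<^esub> b) (inv\<^bsub>X\<^esub> x), inv\<^bsub>B\<^esub> b) \<otimes>\<^bsub>S\<^esub> (x, b) = \<one>\<^bsub>S\<^esub>"
  using assms by simp

lemma group_semidirect: "group S"
proof (rule groupI)
  show "\<exists>v\<in>carrier S. v \<otimes>\<^bsub>S\<^esub> u = \<one>\<^bsub>S\<^esub>" if "u \<in> carrier S" for u
    using that semidirect_l_inv
    by (intro bexI[of _ "(\<phi> (inv\<^bsub>B\<^esub> snd u) (inv\<^bsub>X\<^esub> fst u), inv\<^bsub>B\<^esub> snd u)"]) auto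
qed (auto simp: X.m_assoc B.m_assoc action_comp)

sublocale S: group S
  by (rule group_semidirect)

lemma inv_semidirect:
  assumes "x \<in> carrier X" "b \<in> carrier B"
  shows "inv\<^bsub>S\<^esub> (x, b) = (\<phi> (inv\<^bsub>B\<^esub> b) (inv\<^bsub>X\<^esub> x), inv\<^bsub>B\<^esub> b)"
  using assms semidirect_l_inv by (intro S.inv_equality) auto

text \<open>All maps involved are homomorphisms, so preserving or reflecting the order is a matter
  of differences, hence of membership in cones. The three conditions besides the cone axioms encode
  the embedding of \<open>X\<close>, the section and the projection.\<close>

lemma compatible_cone_iff:
  "compatible_cone X B \<phi> P \<longleftrightarrow>
     positive_cone S P \<and>
     (\<forall>x\<in>carrier X. (x, \<one>\<^bsub>B\<^esub>) \<in> P \<longleftrightarrow> x \<in> pos_elems X) \<and>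
     (\<forall>b\<in>pos_elems B. (\<one>\<^bsub>X\<^esub>, b) \<in> P) \<and>
     snd ` P \<subseteq> pos_elems B"
  (is "_ \<longleftrightarrow> ?R")
proof
  let ?E = "ord_by_cone S P"
  let ?k = "\<lambda>x. (x, \<one>\<^bsub>B\<^esub>)" and ?s = "\<lambda>b. (\<one>\<^bsub>X\<^esub>, b)"
  assume "compatible_cone X B \<phi> P"
  then have P: "positive_cone S P" and p: "snd \<in> ord_hom ?E B"
    and s: "?s \<in> ord_hom B ?E" and k: "ord_kernel X ?E B ?k snd"
    by (auto simp: compatible_cone_def split_extension_def)
  have "(x, \<one>\<^bsub>B\<^esub>) \<in> P \<longleftrightarrow> x \<in> pos_elems X" if "x \<in> carrier X" for x
  proof -
    have "\<one>\<^bsub>X\<^esub> \<preceq>\<^bsub>X\<^esub> x \<longleftrightarrow> ?k \<one>\<^bsub>X\<^esub> \<preceq>\<^bsub>?E\<^esub> ?k x"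
      using k that X.one_closed unfolding ord_kernel_def by blast
    then show ?thesis using that by (simp add: pos_elems_def inv_semidirect)
  qed
  moreover have "(\<one>\<^bsub>X\<^esub>, b) \<in> P" if "b \<in> pos_elems B" for b
  proof -
    have "?s \<one>\<^bsub>B\<^esub> \<preceq>\<^bsub>?E\<^esub> ?s b"
      using s that B.one_closed unfolding ord_hom_def pos_elems_def by blast
    then show ?thesis using B.pos_elems_closed[OF that] by (simp add: inv_semidirect)
  qed
  moreover have "snd u \<in> pos_elems B" if "u \<in> P" for u
  proof -
    have u: "u \<in> carrier S" using that positive_coneD(1)[OF P] by blast
    then have "\<one>\<^bsub>S\<^esub> \<preceq>\<^bsub>?E\<^esub> u" using that by (cases u) (simp add: inv_semidirect)
    then have "snd \<one>\<^bsub>S\<^esub> \<preceq>\<^bsub>B\<^esub> snd u"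
      using p u S.one_closed unfolding ord_hom_def ord_by_cone_simps(1) by blast
    then show ?thesis using u by (auto simp: pos_elems_def)
  qed
  ultimately show ?R using P by blast
next
  let ?E = "ord_by_cone S P"
  let ?k = "\<lambda>x. (x, \<one>\<^bsub>B\<^esub>)" and ?s = "\<lambda>b. (\<one>\<^bsub>X\<^esub>, b)"
  assume ?R
  then have P: "positive_cone S P"
    and PX: "\<And>x. x \<in> carrier X \<Longrightarrow> (x, \<one>\<^bsub>B\<^esub>) \<in> P \<longleftrightarrow> x \<in> pos_elems X"
    and PB: "\<And>b. b \<in> pos_elems B \<Longrightarrow> (\<one>\<^bsub>X\<^esub>, b) \<in> P"
    and Psnd: "\<And>x b. (x, b) \<in> P \<Longrightarrow> b \<in> pos_elems B"
    by auto
  have E: "ordered_group ?E" using group_semidirect P by (rule ordered_group_ord_by_cone)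
  have k_leq: "x \<preceq>\<^bsub>X\<^esub> y \<longleftrightarrow> ?k x \<preceq>\<^bsub>?E\<^esub> ?k y" if "x \<in> carrier X" "y \<in> carrier X" for x y
    using that PX by (simp add: X.leq_iff_pos inv_semidirect)
  have k: "?k \<in> ord_hom X ?E"
    using k_leq by (auto simp: ord_hom_def hom_def)
  have p: "snd \<in> ord_hom ?E B"
    by (auto simp: ord_hom_def hom_def B.leq_iff_pos inv_semidirect dest: Psnd)
  have s: "?s \<in> ord_hom B ?E"
    using PB by (auto simp: ord_hom_def hom_def B.leq_iff_pos inv_semidirect)
  have ker: "ord_kernel X ?E B ?k snd"
    using k k_leq by (auto simp: ord_kernel_def kernel_def inj_on_def)
  have "ord_cokernel TYPE('x \<times> 'b) X ?E B ?k snd"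
    unfolding ord_cokernel_def
  proof (intro conjI allI impI ballI)
    fix Z :: "('x \<times> 'b) ord_group" and f
    assume Z: "ordered_group Z" and f: "f \<in> ord_hom ?E Z" and fk: "\<forall>a\<in>carrier X. f (?k a) = \<one>\<^bsub>Z\<^esub>"
    interpret Z: ordered_group Z by fact
    \<comment> \<open>Since \<open>f\<close> kills the factor from \<open>X\<close> in the
      decomposition of a pair, its value depends on the second component alone.\<close>
    have f_snd: "f (\<one>\<^bsub>X\<^esub>, b) = f (x, b)" if "x \<in> carrier X" "b \<in> carrier B" for x b
    proof -
      have "f (?k x \<otimes>\<^bsub>?E\<^esub> ?s b) = f (?k x) \<otimes>\<^bsub>Z\<^esub> f (?s b)" and "f (?s b) \<in> carrier Z"
        using f that hom_mult[of f ?E Z "?k x" "?s b"] hom_in_carrier[of f ?E Z "?s b"]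
        by (simp_all add: ord_hom_def)
      then show ?thesis using that fk by simp
    qed
    show "\<exists>g\<in>ord_hom B Z. (\<forall>e\<in>carrier ?E. g (snd e) = f e) \<and>
        (\<forall>h\<in>ord_hom B Z. (\<forall>e\<in>carrier ?E. h (snd e) = f e) \<longrightarrow> (\<forall>q\<in>carrier B. h q = g q))"
    \<comment> \<open>The factorization is \<open>f\<close> along the section. It is unique because
      \<open>snd\<close> maps the section onto all of \<open>B\<close>.\<close>
    proof (intro bexI[of _ "f \<circ> ?s"] conjI ballI impI)
      show "f \<circ> ?s \<in> ord_hom B Z" using s f by (rule ord_hom_comp)
      show "(f \<circ> ?s) (snd e) = f e" if "e \<in> carrier ?E" for e
        using that f_snd[of "fst e" "snd e"] by auto
      show "h b = (f \<circ> ?s) b"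
        if h: "\<forall>e\<in>carrier ?E. h (snd e) = f e" and b: "b \<in> carrier B" for h b
        using bspec[OF h, of "(\<one>\<^bsub>X\<^esub>, b)"] b by simp
    qed
  qed (use p in auto)
  with X.ordered_group_axioms B.ordered_group_axioms E k p s ker P
  show "compatible_cone X B \<phi> P"
    by (simp add: compatible_cone_def split_extension_def)
qed

section \<open>Cones between the product and a compatible cone\<close>

lemma product_subset_compatible_cone:
  assumes "compatible_cone X B \<phi> P"
  shows "pos_elems X \<times> pos_elems B \<subseteq> P"
proof clarify
  fix x b assume x: "x \<in> pos_elems X" and b: "b \<in> pos_elems B"
  have P: "positive_cone S P" and "(x, \<one>\<^bsub>B\<^esub>) \<in> P" "(\<one>\<^bsub>X\<^esub>, b) \<in> P"
    using assms x b X.pos_elems_closed by (auto simp: compatible_cone_iff)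
  then have "(x, \<one>\<^bsub>B\<^esub>) \<otimes>\<^bsub>S\<^esub> (\<one>\<^bsub>X\<^esub>, b) \<in> P" by (rule positive_coneD(3))
  then show "(x, b) \<in> P"
    using x b by (simp add: X.pos_elems_closed B.pos_elems_closed)
qed

lemma product_subset_carrier: "pos_elems X \<times> pos_elems B \<subseteq> carrier S"
  by (auto simp: X.pos_elems_closed B.pos_elems_closed)

text \<open>In \<open>compatible_cone_iff\<close>, the memberships that are demanded are inherited
  upwards from the product, and the restrictions on members are inherited downwards from
  \<open>P\<close>.\<close>

lemma compatible_cone_between:
  assumes P: "compatible_cone X B \<phi> P" and C: "positive_cone S C"
    and sub: "pos_elems X \<times> pos_elems B \<subseteq> C" "C \<subseteq> P"
  shows "compatible_cone X B \<phi> C"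
proof -
  \<comment> \<open>Positivity of the units places the images of both positive cones inside the
    product.\<close>
  have "\<one>\<^bsub>X\<^esub> \<in> pos_elems X" "\<one>\<^bsub>B\<^esub> \<in> pos_elems B"
    by (simp_all add: positive_coneD(2) X.positive_cone_pos_elems B.positive_cone_pos_elems)
  then show ?thesis
    using P C sub unfolding compatible_cone_iff by blast
qed

text \<open>Conjugating \<open>x\<close> by the section at \<open>b\<close> realizes the action
  inside \<open>S\<close>. This covers every \<open>b\<close> in the group, positive or not, as the
  conjugation step for the product cone requires.\<close>

lemma action_pos:
  assumes P: "compatible_cone X B \<phi> P" and b: "b \<in> carrier B" and x: "x \<in> pos_elems X"
  shows "\<phi> b x \<in> pos_elems X"
proof -
  have cone: "positive_cone S P" and "(x, \<one>\<^bsub>B\<^esub>) \<in> P"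
    using P x X.pos_elems_closed by (auto simp: compatible_cone_iff)
  then have "(\<one>\<^bsub>X\<^esub>, b) \<otimes>\<^bsub>S\<^esub> (x, \<one>\<^bsub>B\<^esub>) \<otimes>\<^bsub>S\<^esub> inv\<^bsub>S\<^esub> (\<one>\<^bsub>X\<^esub>, b) \<in> P"
    using b by (intro positive_coneD(4)) auto
  then have "(\<phi> b x, \<one>\<^bsub>B\<^esub>) \<in> P"
    using b x by (simp add: inv_semidirect X.pos_elems_closed)
  then show ?thesis
    using P b x by (simp add: compatible_cone_iff X.pos_elems_closed)
qed

lemma action_equiv_id_if_cone:
  assumes C: "positive_cone S (pos_elems X \<times> pos_elems B)"
    and b: "b \<in> pos_elems B" and x: "x \<in> carrier X"
  shows "order_equiv X (\<phi> b x) x"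
proof -
  have bc: "b \<in> carrier B" using b by (rule B.pos_elems_closed)
  have conj: "y \<otimes>\<^bsub>X\<^esub> inv\<^bsub>X\<^esub> \<phi> b y \<in> pos_elems X" if y: "y \<in> carrier X" for y
  proof -
    have "(\<one>\<^bsub>X\<^esub>, b) \<in> pos_elems X \<times> pos_elems B"
      using b positive_coneD(2)[OF X.positive_cone_pos_elems] by simp
    then have "(y, \<one>\<^bsub>B\<^esub>) \<otimes>\<^bsub>S\<^esub> (\<one>\<^bsub>X\<^esub>, b) \<otimes>\<^bsub>S\<^esub> inv\<^bsub>S\<^esub> (y, \<one>\<^bsub>B\<^esub>) \<in> pos_elems X \<times> pos_elems B"
      using y by (intro positive_coneD(4)[OF C]) auto
    then show ?thesis using y bc by (simp add: inv_semidirect)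
  qed
  have "inv\<^bsub>X\<^esub> x \<otimes>\<^bsub>X\<^esub> \<phi> b x \<in> pos_elems X"
    using conj[of "inv\<^bsub>X\<^esub> x"] x bc by simp
  then have "x \<otimes>\<^bsub>X\<^esub> (inv\<^bsub>X\<^esub> x \<otimes>\<^bsub>X\<^esub> \<phi> b x) \<otimes>\<^bsub>X\<^esub> inv\<^bsub>X\<^esub> x \<in> pos_elems X"
    using x by (intro positive_coneD(4)[OF X.positive_cone_pos_elems])
  then have "\<phi> b x \<otimes>\<^bsub>X\<^esub> inv\<^bsub>X\<^esub> x \<in> pos_elems X"
    using x bc by (simp add: X.m_assoc[symmetric])
  then show ?thesis
    using conj[OF x] x bc by (simp add: order_equiv_def X.leq_iff_pos)
qed

lemma cone_if_action_equiv_id: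
  assumes P: "compatible_cone X B \<phi> P"
    and equiv: "\<And>b x. \<lbrakk>b \<in> pos_elems B; x \<in> carrier X\<rbrakk> \<Longrightarrow> order_equiv X (\<phi> b x) x"
  shows "positive_cone S (pos_elems X \<times> pos_elems B)"
proof (rule positive_coneI)
  note XD = positive_coneD[OF X.positive_cone_pos_elems]
    and BD = positive_coneD[OF B.positive_cone_pos_elems]
  show "pos_elems X \<times> pos_elems B \<subseteq> carrier S" by (rule product_subset_carrier)
  show "\<one>\<^bsub>S\<^esub> \<in> pos_elems X \<times> pos_elems B" using XD(2) BD(2) by simp
  show "u \<otimes>\<^bsub>S\<^esub> v \<in> pos_elems X \<times> pos_elems B"
    if "u \<in> pos_elems X \<times> pos_elems B" "v \<in> pos_elems X \<times> pos_elems B" for u v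
    \<comment> \<open>The first component of the product contains a translate under the action,
      hence the appeal to \<open>action_pos\<close>.\<close>
    using that XD(3) BD(3) action_pos[OF P] B.pos_elems_closed
    by (cases u; cases v) simp
  show "g \<otimes>\<^bsub>S\<^esub> u \<otimes>\<^bsub>S\<^esub> inv\<^bsub>S\<^esub> g \<in> pos_elems X \<times> pos_elems B"
    if g: "g \<in> carrier S" and u: "u \<in> pos_elems X \<times> pos_elems B" for g u
  proof -
    obtain y c where [simp]: "g = (y, c)" and y: "y \<in> carrier X" and c: "c \<in> carrier B"
      using g by auto
    obtain x b where [simp]: "u = (x, b)" and x: "x \<in> pos_elems X" and b: "b \<in> pos_elems B"
      using u by auto
    note closed = y c X.pos_elems_closed[OF x] B.pos_elems_closed[OF b]
    \<comment> \<open>This is the second component of the conjugate. It is positive again, so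
      \<open>equiv\<close> applies to it.\<close>
    define d where "d = c \<otimes>\<^bsub>B\<^esub> b \<otimes>\<^bsub>B\<^esub> inv\<^bsub>B\<^esub> c"
    have d: "d \<in> pos_elems B" unfolding d_def using c b by (rule BD(4))
    then have dc: "d \<in> carrier B" by (rule B.pos_elems_closed)
    have "\<phi> (c \<otimes>\<^bsub>B\<^esub> b) (\<phi> (inv\<^bsub>B\<^esub> c) (inv\<^bsub>X\<^esub> y)) = \<phi> d (inv\<^bsub>X\<^esub> y)"
      unfolding d_def using closed by (intro action_comp[symmetric]) auto
    then have eq: "g \<otimes>\<^bsub>S\<^esub> u \<otimes>\<^bsub>S\<^esub> inv\<^bsub>S\<^esub> g = (y \<otimes>\<^bsub>X\<^esub> \<phi> c x \<otimes>\<^bsub>X\<^esub> \<phi> d (inv\<^bsub>X\<^esub> y), d)"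
      \<comment> \<open>\<open>action_inv\<close> is withheld to keep \<phi> applied to the inverse
        of \<open>y\<close>, the form in which \<open>equiv\<close> is used below.\<close>
      using closed by (simp add: inv_semidirect d_def del: action_inv)
    have "y \<otimes>\<^bsub>X\<^esub> \<phi> c x \<otimes>\<^bsub>X\<^esub> inv\<^bsub>X\<^esub> y \<in> pos_elems X"
      using y action_pos[OF P c x] by (rule XD(4))
    moreover have "inv\<^bsub>X\<^esub> y \<preceq>\<^bsub>X\<^esub> \<phi> d (inv\<^bsub>X\<^esub> y)"
      using equiv[OF d X.inv_closed[OF y]] by (simp add: order_equiv_def)
    then have "y \<otimes>\<^bsub>X\<^esub> \<phi> c x \<otimes>\<^bsub>X\<^esub> inv\<^bsub>X\<^esub> y \<preceq>\<^bsub>X\<^esub> y \<otimes>\<^bsub>X\<^esub> \<phi> c x \<otimes>\<^bsub>X\<^esub> \<phi> d (inv\<^bsub>X\<^esub> y)"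
      using closed dc by (intro X.mult_mono X.leq_refl) (auto simp del: action_inv)
    ultimately have "y \<otimes>\<^bsub>X\<^esub> \<phi> c x \<otimes>\<^bsub>X\<^esub> \<phi> d (inv\<^bsub>X\<^esub> y) \<in> pos_elems X"
      by (rule X.pos_elems_trans) (use closed dc in auto)
    then show ?thesis unfolding eq using d by simp
  qed
qed

end

theorem proposition3p5:
  fixes X :: "'x ord_group" and B :: "'b ord_group" and \<phi> :: "'b \<Rightarrow> 'x \<Rightarrow> 'x"
  assumes "ordered_group X" and "ordered_group B"
    and "group_action B (carrier X) \<phi>"
    and "\<And>b. b \<in> carrier B \<Longrightarrow> \<phi> b \<in> hom X X"
    and "\<exists>P. compatible_cone X B \<phi> P"
  defines "P\<^sub>\<Pi> \<equiv> pos_elems X \<times> pos_elems B"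
  shows "(compatible_cone X B \<phi> (generated_cone (semidirect X B \<phi>) P\<^sub>\<Pi>) \<and>
          (\<forall>P. compatible_cone X B \<phi> P \<longrightarrow> generated_cone (semidirect X B \<phi>) P\<^sub>\<Pi> \<subseteq> P)) \<and>
         (generated_cone (semidirect X B \<phi>) P\<^sub>\<Pi> = P\<^sub>\<Pi> \<longleftrightarrow>
          (\<forall>b\<in>pos_elems B. \<forall>x\<in>carrier X. order_equiv X (\<phi> b x) x))"
proof -
  interpret ordered_group_action X B \<phi>
    using assms(1-4) by (simp add: ordered_group_action_def ordered_group_action_axioms_def)
  obtain P where P: "compatible_cone X B \<phi> P" using assms(5) by blast
  have least: "generated_cone S P\<^sub>\<Pi> \<subseteq> Q" if "compatible_cone X B \<phi> Q" for Q
    using that product_subset_compatible_cone[OF that] unfolding P\<^sub>\<Pi>_def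
    by (intro generated_cone_minimal) (auto simp: compatible_cone_def)
  \<comment> \<open>The assumed compatible cone \<open>P\<close> serves as the upper bound of the
    squeeze.\<close>
  have "compatible_cone X B \<phi> (generated_cone S P\<^sub>\<Pi>)"
    using S.positive_cone_generated_cone[OF product_subset_carrier]
      generated_cone_superset least[OF P]
    unfolding P\<^sub>\<Pi>_def by (intro compatible_cone_between[OF P])
  moreover have "generated_cone S P\<^sub>\<Pi> = P\<^sub>\<Pi> \<longleftrightarrow>
      (\<forall>b\<in>pos_elems B. \<forall>x\<in>carrier X. order_equiv X (\<phi> b x) x)"
    unfolding P\<^sub>\<Pi>_def S.generated_cone_eq_iff[OF product_subset_carrier]
    using action_equiv_id_if_cone cone_if_action_equiv_id[OF P] by blast
  ultimately show ?thesis using least by blast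
qed

end
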